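(* For every integer $n\ge 3$, the transposition Cayley graph $Sym_n(T)$ satisfies $N(Sym_n(T),1)=3$.
   Context: For an integer $n$, $Sym_n$ is the symmetric group on $\{1,\dots,n\}$. The transposition Cayley graph $Sym_n(T)$ is the graph with vertex set $Sym_n$ and edges $\{g,gs\}$ for $g\in Sym_n$, $s\in T$, where $T=\{t_{i,j}: 1\le i<j\le n\}$ is the set of all transpositions ($t_{i,j}$ is the transposition interchanging $i$ and $j$). For a finite connected simple graph $\Gamma$ with vertex set $V(\Gamma)$ and path distance $d$, let $B_r(x)=\{y\in V(\Gamma): d(x,y)\le r\}$ and $$N(\Gamma,r)=\max_{x,y\in V(\Gamma),\ x\ne y}|B_r(x)\cap B_r(y)|.$$ *)

theory Defs
  imports
    "HOL-Algebra.Sym_Groups"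
    "HOL-Combinatorics.Transposition"
    "Graph_Theory.Digraph_Component"
    "Graph_Theory.Pair_Digraph"
    "Graph_Theory.Shortest_Path"
begin

text \<open>
  A finite simple graph is a symmetric loop-free finite digraph without parallel arcs
  (\<^locale>\<open>pair_graph\<close>): an undirected edge between \<open>u\<close> and \<open>v\<close> is the pair of
  arcs \<open>(u, v)\<close>, \<open>(v, u)\<close>.
\<close>

definition cayley_graph :: "('a, 'm) monoid_scheme \<Rightarrow> 'a set \<Rightarrow> 'a pair_pre_digraph" where
  "cayley_graph G S =
    \<lparr> pverts = carrier G,
      parcs = {(u, v). \<exists>g\<in>carrier G. \<exists>s\<in>S. {u, v} = {g, g \<otimes>\<^bsub>G\<^esub> s}} \<rparr>"

definition transpositions :: "nat \<Rightarrow> (nat \<Rightarrow> nat) set" where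
  "transpositions n = {transpose i j | i j. 1 \<le> i \<and> i < j \<and> j \<le> n}"

definition transposition_cayley_graph :: "nat \<Rightarrow> (nat \<Rightarrow> nat) pair_pre_digraph" where
  "transposition_cayley_graph n = cayley_graph (sym_group n) (transpositions n)"

text \<open>
  With unit arc weights the cost of a walk is its length.  \<^const>\<open>wf_digraph.\<mu>\<close> can only be
  unfolded for a well-formed digraph.
\<close>

definition path_dist :: "('a, 'b) pre_digraph \<Rightarrow> 'a \<Rightarrow> 'a \<Rightarrow> ereal" where
  "path_dist \<Gamma> x y = wf_digraph.\<mu> \<Gamma> (\<lambda>_. 1) x y"

definition metric_ball :: "('a, 'b) pre_digraph \<Rightarrow> nat \<Rightarrow> 'a \<Rightarrow> 'a set" where
  "metric_ball \<Gamma> r x = {y \<in> verts \<Gamma>. path_dist \<Gamma> x y \<le> ereal (real r)}"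

text \<open>
  The maximum is only meaningful for a finite graph with at least two vertices.
\<close>

definition max_ball_intersection :: "('a, 'b) pre_digraph \<Rightarrow> nat \<Rightarrow> nat" where
  "max_ball_intersection \<Gamma> r =
    Max {card (metric_ball \<Gamma> r x \<inter> metric_ball \<Gamma> r y) | x y.
      x \<in> verts \<Gamma> \<and> y \<in> verts \<Gamma> \<and> x \<noteq> y}"

lemma pverts_transposition_cayley_graph:
  "pverts (transposition_cayley_graph n) = {p. p permutes {1..n}}"
  by (simp add: transposition_cayley_graph_def cayley_graph_def sym_group_def)

lemma parcs_transposition_cayley_graph:
  "parcs (transposition_cayley_graph n) =
    {(u, v). \<exists>g s. g permutes {1..n} \<and> s \<in> transpositions n \<and> {u, v} = {g, g \<circ> s}}"
  by (auto simp: transposition_cayley_graph_def cayley_graph_def sym_group_def)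

lemma transpositions_permutes: "s \<in> transpositions n \<Longrightarrow> s permutes {1..n}"
  by (auto simp: transpositions_def intro!: permutes_swap_id)

lemma comp_transposition_neq:
  assumes "g permutes {1..n}" "s \<in> transpositions n"
  shows "g \<circ> s \<noteq> g"
proof
  assume eq: "g \<circ> s = g"
  obtain i j where ij: "s = transpose i j" "i < j"
    using assms(2) by (auto simp: transpositions_def)
  have "g j = g i"
    using fun_cong[OF eq, of i] ij by simp
  then show False
    using permutes_inj[OF assms(1)] ij(2) by (auto dest: injD)
qed

lemma pair_graph_transposition_cayley_graph: "pair_graph (transposition_cayley_graph n)"
proof -
  let ?\<Gamma> = "transposition_cayley_graph n"
  have wf: "u \<in> pverts ?\<Gamma> \<and> v \<in> pverts ?\<Gamma> \<and> u \<noteq> v \<and> (v, u) \<in> parcs ?\<Gamma>"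
    if "(u, v) \<in> parcs ?\<Gamma>" for u v
  proof -
    obtain g s where gs: "g permutes {1..n}" "s \<in> transpositions n" "{u, v} = {g, g \<circ> s}"
      using \<open>(u, v) \<in> parcs ?\<Gamma>\<close> by (auto simp: parcs_transposition_cayley_graph)
    have "(g \<circ> s) permutes {1..n}"
      using gs transpositions_permutes permutes_compose by blast
    moreover have "g \<circ> s \<noteq> g"
      using gs comp_transposition_neq by blast
    moreover have "{v, u} = {g, g \<circ> s}"
      using gs(3) by (simp add: insert_commute)
    ultimately show ?thesis
      using gs unfolding pverts_transposition_cayley_graph parcs_transposition_cayley_graph
      by (auto simp: doubleton_eq_iff)
  qed
  have fin: "finite (pverts ?\<Gamma>)"
    by (simp add: pverts_transposition_cayley_graph finite_permutations)
  have "parcs ?\<Gamma> \<subseteq> pverts ?\<Gamma> \<times> pverts ?\<Gamma>"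
    using wf by auto
  then have "finite (parcs ?\<Gamma>)"
    using fin finite_subset by blast
  with fin wf show ?thesis
    by unfold_locales (auto simp: symmetric_def sym_def)
qed

lemma connected_transposition_cayley_graph:
  "strongly_connected (transposition_cayley_graph n)"
proof -
  let ?\<Gamma> = "transposition_cayley_graph n"
  interpret pair_graph ?\<Gamma>
    by (rule pair_graph_transposition_cayley_graph)
  have reach: "\<forall>g. g permutes {1..n} \<longrightarrow> g \<rightarrow>\<^sup>*\<^bsub>with_proj ?\<Gamma>\<^esub> (g \<circ> p)" if "p permutes {1..n}" for p
    using that finite_atLeastAtMost
  proof (induction rule: permutes_induct)
    case id
    then show ?case
      by (auto simp: pverts_transposition_cayley_graph)
  next
    case (swap a b q)
    show ?case
    proof (intro allI impI)
      fix g assume g: "g permutes {1..n}"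
      have t: "transpose a b permutes {1..n}"
        using swap.hyps by (simp add: permutes_swap_id)
      have gt: "(g \<circ> transpose a b) permutes {1..n}"
        using permutes_compose[OF t g] .
      show "g \<rightarrow>\<^sup>*\<^bsub>with_proj ?\<Gamma>\<^esub> (g \<circ> (transpose a b \<circ> q))"
      proof -
        have neq: "a \<noteq> b"
          using swap.hyps by blast
        have "transpose a b = transpose (min a b) (max a b)"
          by (cases "a \<le> b") (simp_all add: min_def max_def transpose_commute)
        moreover have "1 \<le> min a b" "min a b < max a b" "max a b \<le> n"
          using swap.hyps neq by auto
        ultimately have "transpose a b \<in> transpositions n"
          unfolding transpositions_def by blast
        then have "(g, g \<circ> transpose a b) \<in> parcs ?\<Gamma>"
          using g unfolding parcs_transposition_cayley_graph by blast
        then have "g \<rightarrow>\<^bsub>with_proj ?\<Gamma>\<^esub> (g \<circ> transpose a b)"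
          by simp
        moreover have "(g \<circ> transpose a b) \<rightarrow>\<^sup>*\<^bsub>with_proj ?\<Gamma>\<^esub> (g \<circ> transpose a b \<circ> q)"
          using swap.IH gt by blast
        ultimately show ?thesis
          unfolding comp_assoc by (rule wf_digraph.adj_reachable_trans[OF wf_digraph])
      qed
    qed
  qed
  have "u \<rightarrow>\<^sup>*\<^bsub>with_proj ?\<Gamma>\<^esub> v" if uv: "u permutes {1..n}" "v permutes {1..n}" for u v
  proof -
    have "(Hilbert_Choice.inv u \<circ> v) permutes {1..n}"
      using uv permutes_inv permutes_compose by blast
    then have "u \<rightarrow>\<^sup>*\<^bsub>with_proj ?\<Gamma>\<^esub> (u \<circ> (Hilbert_Choice.inv u \<circ> v))"
      using reach uv(1) by blast
    then show ?thesis
      unfolding comp_assoc[symmetric] permutes_inv_o(1)[OF uv(1)] by simp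
  qed
  moreover have "id permutes {1..n}"
    by (rule permutes_id)
  ultimately show ?thesis
    unfolding strongly_connected_def with_proj_simps pverts_transposition_cayley_graph by blast
qed

end

theory Submission
  imports Defs
begin

text \<open>
  The unit ball around \<open>x\<close> consists of the products \<open>x \<circ> s\<close> where \<open>s\<close> is a transposition or the
  identity, so the common points of the unit balls around \<open>x\<close> and \<open>y\<close> correspond to factorisations
  \<open>w = s \<circ> t\<close> of \<open>w = x\<^sup>-\<^sup>1 \<circ> y\<close>.  If \<open>w\<close> moves a point \<open>a\<close>, then following \<open>a\<close> through \<open>t\<close> and \<open>s\<close>
  leaves only three candidates for \<open>s\<close>.  The 3-cycle \<open>w = (1 2)(2 3)\<close> attains the bound.
\<close>

text \<open>\<open>\<mu>\<close> is an infimum of walk costs, and unit weights make these costs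
  lengths. A walk of length at most 1 is empty, which requires its endpoint to be a vertex, or a
  single arc.\<close>

lemma (in wf_digraph) mu_unit_le_1_iff:
  "\<mu> (\<lambda>_. 1) u v \<le> 1 \<longleftrightarrow> u = v \<and> u \<in> verts G \<or> u \<rightarrow> v"
proof
  have cost: "awalk_cost (\<lambda>_. 1) p = real (length p)" for p :: "'b list"
    by (induction p) auto
  assume "\<mu> (\<lambda>_. 1) u v \<le> 1"
  \<comment> \<open>A strict bound on an infimum yields an actual walk below it; as lengths are
    integers, relaxing to \<open>< 2\<close> loses nothing.\<close>
  then have "\<mu> (\<lambda>_. 1) u v < ereal 2"
    by (rule le_less_trans) simp
  then obtain p where p: "awalk u p v" "length p < 2"
    unfolding \<mu>_def INF_less_iff by (auto simp: cost)
  then consider "p = []" | e where "p = [e]"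
    by (cases p; cases "tl p") auto
  then show "u = v \<and> u \<in> verts G \<or> u \<rightarrow> v"
    using p(1) by cases (auto simp: awalk_simps intro: in_arcs_imp_in_arcs_ends)
next
  assume "u = v \<and> u \<in> verts G \<or> u \<rightarrow> v"
  then show "\<mu> (\<lambda>_. 1) u v \<le> 1"
  proof
    assume "u = v \<and> u \<in> verts G"
    then have "\<mu> (\<lambda>_. 1) u v \<le> awalk_cost (\<lambda>_. 1) []"
      by (intro min_cost_le_walk_cost) (auto simp: awalk_simps)
    also have "\<dots> \<le> (1 :: ereal)"
      by simp
    finally show ?thesis .
  next
    assume "u \<rightarrow> v"
    then obtain e where "e \<in> arcs G" "tail G e = u" "head G e = v"
      by auto
    then have "\<mu> (\<lambda>_. 1) u v \<le> awalk_cost (\<lambda>_. 1) [e]"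
      by (intro min_cost_le_walk_cost) (auto simp: awalk_simps)
    then show ?thesis
      by (simp add: one_ereal_def)
  qed
qed

lemma (in wf_digraph) metric_ball_1:
  assumes "u \<in> verts G"
  shows "metric_ball G 1 u = insert u {v. u \<rightarrow> v}"
  using assms mu_unit_le_1_iff
  by (auto simp: metric_ball_def path_dist_def one_ereal_def[symmetric])

text \<open>A transposition moving \<open>x\<close> can only swap \<open>x\<close> with its image,
  so a single moved point determines it.\<close>

lemma transpose_eq_transpose_moved:
  assumes "transpose i j x \<noteq> x"
  shows "transpose i j = transpose x (transpose i j x)"
  using assms by (cases "x = i"; cases "x = j") (auto simp: transpose_commute)

text \<open>The degenerate transpositions \<open>transpose i i = id\<close> are included.\<close>

lemma transpose_comp_transpose_left_factor:
  assumes w: "w = transpose i j \<circ> transpose k l" and moved: "w a \<noteq> a"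
  shows "transpose i j \<in>
    {transpose a (w a), w \<circ> transpose a (w a), transpose (w a) (Hilbert_Choice.inv w a)}"
proof -
  define b c where "b = w a" and "c = transpose k l a"
  have sc: "transpose i j c = b"
    by (simp add: b_def c_def w)
  consider "c = a" | "c = b" "c \<noteq> a" | "c \<noteq> a" "c \<noteq> b"
    by blast
  then show ?thesis
  proof cases
    \<comment> \<open>The right factor fixes \<open>a\<close>, so the left one takes
      \<open>a\<close> to \<open>b\<close>.\<close>
    case 1
    then have "transpose i j = transpose a b"
      using transpose_eq_transpose_moved sc moved unfolding b_def by metis
    then show ?thesis
      by (simp add: b_def)
  next
    \<comment> \<open>The right factor already swaps \<open>a\<close> and \<open>b\<close>; being an
      involution, it cancels from \<open>w\<close> on the right.\<close>
    case 2
    then have "transpose k l = transpose a b"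
      using transpose_eq_transpose_moved unfolding c_def by metis
    then have "transpose i j = w \<circ> transpose a b"
      by (simp add: w comp_assoc)
    then show ?thesis
      by (simp add: b_def)
  next
    \<comment> \<open>Both factors move the point \<open>c\<close> on the way from \<open>a\<close>
      to \<open>b\<close>. The right one takes \<open>c\<close> back to \<open>a\<close>, which the
      left one fixes, so \<open>c\<close> is the preimage of \<open>a\<close> under
      \<open>w\<close>.\<close>
    case 3
    have s: "transpose i j = transpose c b"
      using transpose_eq_transpose_moved sc 3 by metis
    have "transpose k l = transpose a c"
      using transpose_eq_transpose_moved 3 unfolding c_def by metis
    then have "w c = a"
      using 3 moved by (simp add: w s b_def[symmetric])
    moreover have "bij w"
      unfolding w by (intro bij_comp) simp_all
    ultimately have "Hilbert_Choice.inv w a = c"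
      by (metis bij_is_inj inv_f_f)
    with s show ?thesis
      by (simp add: b_def transpose_commute)
  qed
qed

text \<open>Edges are unordered, so \<open>x\<close> may be either endpoint of
  \<open>{g, g \<circ> s}\<close>; since \<open>s\<close> is an involution, both readings
  agree.\<close>

lemma adj_transposition_cayley_graph_iff:
  assumes "x permutes {1..n}"
  shows "x \<rightarrow>\<^bsub>with_proj (transposition_cayley_graph n)\<^esub> z \<longleftrightarrow>
    (\<exists>s\<in>transpositions n. z = x \<circ> s)" (is "?L \<longleftrightarrow> ?R")
proof
  assume ?L
  then obtain g s where s: "s \<in> transpositions n" and xz: "{x, z} = {g, g \<circ> s}"
    by (auto simp: parcs_transposition_cayley_graph)
  have "s \<circ> s = id"
    using s by (auto simp: transpositions_def)
  with xz have "z = x \<circ> s"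
    by (auto simp: doubleton_eq_iff comp_assoc)
  with s show ?R
    by blast
next
  assume ?R
  with assms show ?L
    by (auto simp: parcs_transposition_cayley_graph)
qed

text \<open>Letting \<open>i = j\<close> absorbs the centre into the same form as its neighbours;
  \<open>n \<ge> 1\<close> supplies such an index.\<close>

lemma metric_ball_transposition_cayley_graph:
  assumes x: "x permutes {1..n}" and "n \<ge> 1"
  shows "metric_ball (with_proj (transposition_cayley_graph n)) 1 x =
    {x \<circ> transpose i j | i j. i \<in> {1..n} \<and> j \<in> {1..n}}" (is "_ = ?R")
proof -
  interpret pair_graph "transposition_cayley_graph n"
    by (rule pair_graph_transposition_cayley_graph)
  have "metric_ball (with_proj (transposition_cayley_graph n)) 1 x =
      insert x {x \<circ> s | s. s \<in> transpositions n}"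
    using adj_transposition_cayley_graph_iff[OF x]
    by (subst metric_ball_1) (use x in \<open>auto simp: pverts_transposition_cayley_graph\<close>)
  also have "\<dots> = ?R"
  proof (rule Set.set_eqI)
    fix z
    have "x \<circ> transpose i j \<in> insert x {x \<circ> s | s. s \<in> transpositions n}"
      if "i \<in> {1..n}" "j \<in> {1..n}" for i j
    proof (cases i j rule: linorder_cases)
      case greater
      then have "transpose i j \<in> transpositions n"
        using that unfolding transpositions_def by (subst transpose_commute) auto
      then show ?thesis
        by blast
    qed (use that in \<open>auto simp: transpositions_def\<close>)
    moreover have "x \<in> ?R"
      using \<open>n \<ge> 1\<close> by (intro CollectI exI[of _ 1]) simp
    moreover have "x \<circ> s \<in> ?R" if s: "s \<in> transpositions n" for s
    proof -
      obtain i j where "s = transpose i j" "i \<in> {1..n}" "j \<in> {1..n}"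
        using s by (auto simp: transpositions_def)
      then show ?thesis
        by blast
    qed
    ultimately show "z \<in> insert x {x \<circ> s | s. s \<in> transpositions n} \<longleftrightarrow> z \<in> ?R"
      by blast
  qed
  finally show ?thesis .
qed

lemma card_metric_ball_inter_le_3:
  assumes x: "x permutes {1..n}" and y: "y permutes {1..n}" and "x \<noteq> y" "n \<ge> 1"
  shows "card (metric_ball (with_proj (transposition_cayley_graph n)) 1 x \<inter>
    metric_ball (with_proj (transposition_cayley_graph n)) 1 y) \<le> 3"
    (is "card ?I \<le> 3")
proof -
  define w where "w = Hilbert_Choice.inv x \<circ> y"
  have xw: "x \<circ> w = y"
    using permutes_inv_o(1)[OF x] by (simp add: w_def comp_assoc[symmetric])
  with \<open>x \<noteq> y\<close> have "w \<noteq> id"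
    by auto
  then obtain a where a: "w a \<noteq> a"
    by (auto simp: fun_eq_iff)
  \<comment> \<open>As a list, the candidates are bounded in number by its length, whether or not
    they coincide.\<close>
  let ?S = "[transpose a (w a), w \<circ> transpose a (w a), transpose (w a) (Hilbert_Choice.inv w a)]"
  have "?I \<subseteq> (\<lambda>s. x \<circ> s) ` set ?S"
  proof
    fix z
    assume "z \<in> ?I"
    then obtain i j k l where z: "z = x \<circ> transpose i j" "z = y \<circ> transpose k l"
      unfolding metric_ball_transposition_cayley_graph[OF x \<open>n \<ge> 1\<close>]
        metric_ball_transposition_cayley_graph[OF y \<open>n \<ge> 1\<close>] by blast
    then have "y = x \<circ> (transpose i j \<circ> transpose k l)"
      by (metis comp_assoc comp_id transpose_comp_involutory)
    then have "w = transpose i j \<circ> transpose k l"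
      using permutes_inv_o(2)[OF x] by (simp add: w_def comp_assoc[symmetric])
    from transpose_comp_transpose_left_factor[OF this a] z(1)
    show "z \<in> (\<lambda>s. x \<circ> s) ` set ?S"
      by auto
  qed
  then have "card ?I \<le> card ((\<lambda>s. x \<circ> s) ` set ?S)"
    by (intro card_mono) auto
  also have "\<dots> \<le> card (set ?S)"
    by (intro card_image_le) simp
  also have "\<dots> \<le> 3"
    using card_length[of ?S] by simp
  finally show ?thesis .
qed

text \<open>A 3-cycle times a transposition of \<open>{1, 2, 3}\<close> is odd, hence again a
  transposition; all three arise this way.\<close>

lemma three_cycle_factorisations:
  "transpose 1 3 = transpose 1 2 \<circ> transpose 2 3 \<circ> transpose 1 (2::nat)"
  "transpose 2 3 = transpose 1 2 \<circ> transpose 2 3 \<circ> transpose 1 (3::nat)"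
  "transpose 1 2 = transpose 1 2 \<circ> transpose 2 3 \<circ> transpose 2 (3::nat)"
  by (auto simp: fun_eq_iff transpose_def)

theorem theorem3:
  fixes n :: nat
  assumes "n \<ge> 3"
  shows "max_ball_intersection (transposition_cayley_graph n) 1 = 3"
proof -
  let ?\<Gamma> = "with_proj (transposition_cayley_graph n)"
  let ?M = "{card (metric_ball ?\<Gamma> 1 x \<inter> metric_ball ?\<Gamma> 1 y) | x y.
    x \<in> verts ?\<Gamma> \<and> y \<in> verts ?\<Gamma> \<and> x \<noteq> y}"
  have le: "m \<le> 3" if "m \<in> ?M" for m
    using that card_metric_ball_inter_le_3 \<open>n \<ge> 3\<close>
    by (auto simp: pverts_transposition_cayley_graph)
  define y where "y = transpose 1 2 \<circ> transpose 2 (3::nat)"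
  have y: "y permutes {1..n}"
    unfolding y_def using \<open>n \<ge> 3\<close> by (intro permutes_compose permutes_swap_id) auto
  have id: "id permutes {1..n}"
    by (rule permutes_id)
  have "y 1 \<noteq> id 1"
    by (simp add: y_def transpose_def)
  then have "id \<noteq> y"
    by auto
  let ?I = "metric_ball ?\<Gamma> 1 id \<inter> metric_ball ?\<Gamma> 1 y"
  let ?T = "{transpose 1 2, transpose 1 3, transpose 2 (3::nat)}"
  have "n \<ge> 1"
    using \<open>n \<ge> 3\<close> by simp
  have "finite (metric_ball ?\<Gamma> 1 id)"
    by (simp add: metric_ball_def pverts_transposition_cayley_graph finite_permutations)
  moreover have "?T \<subseteq> ?I"
  proof -
    \<comment> \<open>Every transposition is adjacent to \<open>id\<close> or equal to it, so only
      the ball around \<open>y\<close> needs a factorisation.\<close>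
    have "transpose i j \<in> ?I" if "transpose i j = y \<circ> transpose k l"
      "i \<in> {1..n}" "j \<in> {1..n}" "k \<in> {1..n}" "l \<in> {1..n}" for i j k l
    proof
      have "transpose i j = id \<circ> transpose i j"
        by simp
      with that show "transpose i j \<in> metric_ball ?\<Gamma> 1 id"
        unfolding metric_ball_transposition_cayley_graph[OF id \<open>n \<ge> 1\<close>] by blast
      show "transpose i j \<in> metric_ball ?\<Gamma> 1 y"
        unfolding metric_ball_transposition_cayley_graph[OF y \<open>n \<ge> 1\<close>] using that by blast
    qed
    from this[OF three_cycle_factorisations(1)[folded y_def]]
      this[OF three_cycle_factorisations(2)[folded y_def]]
      this[OF three_cycle_factorisations(3)[folded y_def]]
    show ?thesis
      using \<open>n \<ge> 3\<close> by simp
  qed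
  moreover have "card ?T = 3"
  proof -
    have "transpose 1 2 \<noteq> transpose 1 (3::nat)" "transpose 1 2 \<noteq> transpose 2 (3::nat)"
      "transpose 1 3 \<noteq> transpose 2 (3::nat)"
      \<comment> \<open>The three transpositions send 1 to 2, 3 and 1 respectively.\<close>
      by (auto dest!: fun_cong[of _ _ 1] simp: transpose_def)
    then show ?thesis
      by simp
  qed
  ultimately have "card ?I \<ge> 3"
    by (metis card_mono finite_Int)
  moreover have "card ?I \<in> ?M"
  proof (intro CollectI exI conjI)
    show "id \<in> verts ?\<Gamma>" "y \<in> verts ?\<Gamma>"
      using id y by (simp_all add: pverts_transposition_cayley_graph)
  qed (use \<open>id \<noteq> y\<close> in simp_all)
  \<comment> \<open>The lower bound for this pair meets the general upper bound, so the value 3 is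
    attained.\<close>
  ultimately have "3 \<in> ?M"
    using le by (metis (no_types, lifting) le_antisym)
  moreover have "finite ?M"
    by (rule finite_subset[of _ "{..3}"]) (use le in auto)
  ultimately show ?thesis
    unfolding max_ball_intersection_def using le by (intro Max_eqI) blast+
qed

end
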